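(* There is a $2$-clause Achlioptas rule for random $2$-SAT that generates a formula that is satisfiable with high probability (i.e. with probability tending to $1$ as $n\to\infty$) after $1.055\, n$ steps.
   Context: Variables and clauses: the Boolean variables are $x_1,\dots,x_n$, and all asymptotics are as $n\to\infty$. A literal is a variable $x_i$ or its negation $\overline{x}_i$. A $k$-clause is a disjunction of $k$ literals on $k$ distinct variables, so there are $\binom{n}{k}2^k$ possible $k$-clauses. A formula is a conjunction of $k$-clauses; it is satisfiable if some truth assignment to the $n$ variables satisfies every clause. Numbers of steps such as $cn$ are understood up to integer rounding. $l$-clause Achlioptas $k$-SAT process: begin at step $0$ with the empty formula $\Phi_0=\emptyset$. At each step $i\ge 1$, $l$ clauses are selected independently and uniformly at random, with replacement, from the $\binom{n}{k}2^k$ possible $k$-clauses (independently of previous steps). According to a fixed rule $R$, exactly one of the $l$ clauses, $\phi_i$, is chosen, and $\Phi_i=\Phi_{i-1}\wedge\phi_i$. The rule $R$ (an "$l$-clause Achlioptas rule") may depend on the $l$ clauses presented, the current formula $\Phi_{i-1}$, the entire history of presented clauses up to step $i$, and additional randomness, but not on clauses presented in subsequent steps; no efficiency is required of the rule. Here $k=2$ and $l=2$. *)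

theory Defs
  imports "HOL-Probability.Probability"
begin

text \<open>
  The literal \<open>(i, True)\<close> is the variable \<open>x\<^sub>i\<close> and \<open>(i, False)\<close> is its negation.
  A clause is the set of its literals, a formula the sequence of its clauses in the order in which
  they were added.
\<close>

type_synonym literal = "nat \<times> bool"
type_synonym clause = "literal set"
type_synonym formula = "clause list"

definition k_clauses :: "nat \<Rightarrow> nat \<Rightarrow> clause set" where
  "k_clauses k n = {C. C \<subseteq> {1..n} \<times> UNIV \<and> card C = k \<and> inj_on fst C}"

text \<open>
  Assignments are total on \<^typ>\<open>nat\<close>; for a formula over \<open>x\<^sub>1, \<dots>, x\<^sub>n\<close> only the values at
  \<open>1, \<dots>, n\<close> matter.
\<close>

definition satisfies :: "(nat \<Rightarrow> bool) \<Rightarrow> clause \<Rightarrow> bool" where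
  "satisfies \<alpha> C \<longleftrightarrow> (\<exists>(i, b)\<in>C. \<alpha> i = b)"

definition satisfiable :: "formula \<Rightarrow> bool" where
  "satisfiable \<Phi> \<longleftrightarrow> (\<exists>\<alpha>. \<forall>C\<in>set \<Phi>. satisfies \<alpha> C)"

text \<open>
  A history lists, step by step, the clauses presented together with the clause that was chosen
  among them. A rule maps the history of the previous steps and the clauses presented in the
  current step to the distribution of the chosen clause. Because the history records the earlier
  choices, such rules realise every joint law of presented and chosen clauses that a rule with
  additional randomness, possibly remembered from step to step, can produce.
\<close>

type_synonym history = "(clause list \<times> clause) list"
type_synonym rule = "history \<Rightarrow> clause list \<Rightarrow> clause pmf"

definition achlioptas_rule :: "nat \<Rightarrow> nat \<Rightarrow> nat \<Rightarrow> rule \<Rightarrow> bool" where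
  "achlioptas_rule l k n R \<longleftrightarrow>
     (\<forall>H cs. length cs = l \<and> set cs \<subseteq> k_clauses k n \<longrightarrow> set_pmf (R H cs) \<subseteq> set cs)"

definition presented :: "nat \<Rightarrow> nat \<Rightarrow> nat \<Rightarrow> clause list pmf" where
  "presented l k n = replicate_pmf l (pmf_of_set (k_clauses k n))"

primrec achlioptas_process :: "nat \<Rightarrow> nat \<Rightarrow> nat \<Rightarrow> rule \<Rightarrow> nat \<Rightarrow> history pmf" where
  "achlioptas_process l k n R 0 = return_pmf []"
| "achlioptas_process l k n R (Suc m) =
     bind_pmf (achlioptas_process l k n R m) (\<lambda>H.
     bind_pmf (presented l k n) (\<lambda>cs.
     bind_pmf (R H cs) (\<lambda>C.
     return_pmf (H @ [(cs, C)]))))"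

definition achlioptas_formula :: "nat \<Rightarrow> nat \<Rightarrow> nat \<Rightarrow> rule \<Rightarrow> nat \<Rightarrow> formula pmf" where
  "achlioptas_formula l k n R m = map_pmf (map snd) (achlioptas_process l k n R m)"

text \<open>
  \<^const>\<open>pmf_of_set\<close> is the uniform distribution only on finite nonempty sets, which
  \<^term>\<open>k_clauses k n\<close> is whenever \<open>k \<le> n\<close>.
\<close>

lemma finite_k_clauses: "finite (k_clauses k n)"
  by (rule finite_subset[of _ "Pow ({1..n} \<times> UNIV)"]) (auto simp: k_clauses_def)

lemma card_k_clauses: "card (k_clauses k n) = (n choose k) * 2 ^ k"
proof -
  let ?A = "SIGMA S:{S. S \<subseteq> {1..n} \<and> card S = k}. Pow S"
  let ?g = "\<lambda>(S, T). (\<lambda>i. (i, i \<in> T)) ` S"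
  let ?h = "\<lambda>C. (fst ` C, {i. (i, True) \<in> C})"
  have inj: "inj_on (\<lambda>i. (i, i \<in> T)) S" for S T :: "nat set"
    by (auto simp: inj_on_def)
  have "bij_betw ?h (k_clauses k n) ?A"
  proof (rule bij_betw_byWitness[where f' = ?g])
    show "\<forall>C\<in>k_clauses k n. ?g (?h C) = C"
    proof
      fix C assume "C \<in> k_clauses k n"
      then have "inj_on fst C" by (simp add: k_clauses_def)
      then have "(fst p, (fst p, True) \<in> C) = p" if "p \<in> C" for p
        using that inj_onD[OF \<open>inj_on fst C\<close>, of "(fst p, True)" "(fst p, False)"]
        by (cases p; cases "snd p") auto
      then show "?g (?h C) = C" by (auto simp: image_image)
    qed
    show "\<forall>p\<in>?A. ?h (?g p) = p" by (auto simp: image_image)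
    show "?h ` k_clauses k n \<subseteq> ?A"
      by (auto simp: k_clauses_def card_image image_iff) force+
    show "?g ` ?A \<subseteq> k_clauses k n"
      by (auto simp: k_clauses_def card_image[OF inj] inj_on_def)
  qed
  then have "card (k_clauses k n) = card ?A" by (rule bij_betw_same_card)
  also have "\<dots> = (\<Sum>S\<in>{S. S \<subseteq> {1..n} \<and> card S = k}. card (Pow S))"
    by (rule card_SigmaI) (auto intro: finite_subset)
  also have "\<dots> = (\<Sum>S\<in>{S. S \<subseteq> {1..n} \<and> card S = k}. 2 ^ k)"
    by (rule sum.cong) (auto simp: card_Pow finite_subset)
  also have "\<dots> = (n choose k) * 2 ^ k"
    using n_subsets[of "{1..n}" k] by simp
  finally show ?thesis .
qed

lemma k_clauses_nonempty: "k \<le> n \<Longrightarrow> k_clauses k n \<noteq> {}"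
  using card_k_clauses[of k n] by (metis card.empty mult_eq_0_iff binomial_eq_0_iff
    power_not_zero not_le zero_neq_numeral)

end

theory Submission
  imports Defs "HOL-Real_Asymp.Real_Asymp"
begin

text \<open>
  The rule takes the first clause unless all its literals are negative, in which case it takes the
  second one. The chosen clauses are then independent, and with \<open>N = n (n - 1)\<close> a given clause is
  chosen with probability \<open>1 / (8 N)\<close> if it is all negative and \<open>5 / (8 N)\<close> otherwise. An
  unsatisfiable 2-CNF formula contains a bicycle: a path of implications through \<open>s\<close> literals on
  distinct variables, together with one more implication at either end that leads back to these
  variables; it consists of \<open>s + 1\<close> different clauses. After \<open>m\<close> steps the expected number of
  bicycles is at most of order \<open>\<Sum>\<^sub>s s\<^sup>2 \<kappa>\<^sup>s / n\<close>, where \<open>\<kappa>\<close> is \<open>m / n\<close> times a bound on the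
  Perron eigenvalue \<open>(5 + sqrt 5) / 8\<close> of the matrix with rows \<open>(5/8, 1/8)\<close> and
  \<open>(5/8, 5/8)\<close>. For \<open>m = 1.055 n\<close> one gets \<open>\<kappa> < 1\<close>.
\<close>

subsection \<open>Bicycles in unsatisfiable 2-CNF formulas\<close>

definition neg :: "literal \<Rightarrow> literal" where
  "neg l = (fst l, \<not> snd l)"

lemma neg_simps [simp]: "neg (neg l) = l" "fst (neg l) = fst l" "snd (neg l) = (\<not> snd l)"
    "neg l \<noteq> l" "l \<noteq> neg l" "neg l = neg l' \<longleftrightarrow> l = l'"
  by (auto simp: neg_def prod_eq_iff)

lemma same_var_cases: "fst l = fst l' \<Longrightarrow> l = l' \<or> l = neg l'"
  by (auto simp: neg_def prod_eq_iff)

text \<open>Edge relation of the implication digraph: the clause \<open>{neg l, l'}\<close> read as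
  an implication from \<open>l\<close> to \<open>l'\<close>.\<close>

definition implies :: "clause set \<Rightarrow> literal \<Rightarrow> literal \<Rightarrow> bool" where
  "implies F l l' \<longleftrightarrow> {neg l, l'} \<in> F"

lemma implies_contrapos: "implies F l l' \<Longrightarrow> implies F (neg l') (neg l)"
  by (simp add: implies_def insert_commute)

lemma implies_star_contrapos: "(implies F)\<^sup>*\<^sup>* l l' \<Longrightarrow> (implies F)\<^sup>*\<^sup>* (neg l') (neg l)"
  by (induction rule: rtranclp_induct)
     (auto intro: converse_rtranclp_into_rtranclp implies_contrapos)

lemma k_clauses_2E:
  assumes "C \<in> k_clauses 2 n"
  obtains l l' where "C = {l, l'}" "fst l \<noteq> fst l'" "fst l \<in> {1..n}" "fst l' \<in> {1..n}"
proof -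
  from assms obtain l l' where C: "C = {l, l'}" "l \<noteq> l'"
    by (auto simp: k_clauses_def card_2_iff)
  with assms have "fst l \<noteq> fst l'" "fst l \<in> {1..n}" "fst l' \<in> {1..n}"
    by (auto simp: k_clauses_def inj_on_def)
  with C that show ?thesis by blast
qed

lemma implies_var:
  assumes "F \<subseteq> k_clauses 2 n" "implies F l l'"
  shows "fst l \<noteq> fst l'" "fst l \<in> {1..n}" "fst l' \<in> {1..n}"
proof -
  from assms have "{neg l, l'} \<in> k_clauses 2 n" by (auto simp: implies_def)
  then obtain a b where "{neg l, l'} = {a, b}" "fst a \<noteq> fst b" "fst a \<in> {1..n}" "fst b \<in> {1..n}"
    by (rule k_clauses_2E)
  then show "fst l \<noteq> fst l'" "fst l \<in> {1..n}" "fst l' \<in> {1..n}"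
    by (auto simp: doubleton_eq_iff)
qed

text \<open>A maximal consistent set of literals that is closed under implication decides every
  variable, so it is an assignment; closure makes this assignment satisfy each clause.\<close>

lemma satisfiable_if_no_contradictory_cycle:
  assumes F: "F \<subseteq> k_clauses 2 n"
    and nocycle: "\<And>l. \<not> ((implies F)\<^sup>*\<^sup>* l (neg l) \<and> (implies F)\<^sup>*\<^sup>* (neg l) l)"
  shows "\<exists>\<alpha>. \<forall>C\<in>F. satisfies \<alpha> C"
proof -
  let ?L = "{1..n} \<times> (UNIV :: bool set)"
  let ?closed = "\<lambda>S. \<forall>l\<in>S. \<forall>l'. implies F l l' \<longrightarrow> l' \<in> S"
  define \<S> where "\<S> = {S. S \<subseteq> ?L \<and> ?closed S \<and> (\<forall>l\<in>S. neg l \<notin> S)}"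
  have "finite \<S>" unfolding \<S>_def by (rule finite_subset[of _ "Pow ?L"]) auto
  moreover have "\<S> \<noteq> {}" unfolding \<S>_def by blast
  ultimately obtain S where "S \<in> \<S>" and max: "\<And>T. T \<in> \<S> \<Longrightarrow> S \<subseteq> T \<Longrightarrow> S = T"
    using finite_has_maximal[of \<S>] by blast
  then have S: "S \<subseteq> ?L" "?closed S" "\<forall>l\<in>S. neg l \<notin> S" unfolding \<S>_def by simp_all
  have star_closed: "l' \<in> S" if "(implies F)\<^sup>*\<^sup>* l l'" "l \<in> S" for l l'
    using that S by (induction rule: rtranclp_induct) auto
  have complete: "l \<in> S \<or> neg l \<in> S" if l: "l \<in> ?L" for l
  proof (rule ccontr)
    assume not: "\<not> (l \<in> S \<or> neg l \<in> S)"
    \<comment> \<open>Without a contradictory cycle, one literal of an undecided variable does not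
      reach its own negation; it and all that it reaches can be added to \<open>S\<close>.\<close>
    obtain y where y: "y = l \<or> y = neg l" and noty: "\<not> (implies F)\<^sup>*\<^sup>* y (neg y)"
      using nocycle[of l] by (metis neg_simps(1))
    define T where "T = S \<union> {z. (implies F)\<^sup>*\<^sup>* y z}"
    have yL: "y \<in> ?L" "y \<notin> S" "neg y \<notin> S" using y l not by (auto simp: mem_Times_iff)
    have reach_L: "z \<in> ?L" if "(implies F)\<^sup>*\<^sup>* y z" for z
      using that
    proof (cases rule: rtranclp.cases)
      case rtrancl_refl
      then show ?thesis using yL by simp
    next
      case (rtrancl_into_rtrancl b)
      then show ?thesis using implies_var[OF F] by (auto simp: mem_Times_iff)
    qed
    have "neg z \<notin> T" if "z \<in> T" for z
    proof
      assume "neg z \<in> T"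
      \<comment> \<open>By contraposition \<open>z\<close> reaches \<open>neg y\<close>, so closure
        would put \<open>neg y\<close> into \<open>S\<close>.\<close>
      have a: False if "z \<in> S" "(implies F)\<^sup>*\<^sup>* y (neg z)" for z
        using implies_star_contrapos[OF that(2)] star_closed[of z "neg y"] that(1) yL by simp
      \<comment> \<open>Again by contraposition \<open>z\<close> reaches \<open>neg y\<close>, and
        then so does \<open>y\<close> through \<open>z\<close>.\<close>
      have b: False if "(implies F)\<^sup>*\<^sup>* y z" "(implies F)\<^sup>*\<^sup>* y (neg z)"
        using implies_star_contrapos[OF that(2)] that(1) noty by (simp, meson rtranclp_trans)
      show False
        using \<open>z \<in> T\<close> \<open>neg z \<in> T\<close> S a[of z] a[of "neg z"] b by (auto simp: T_def)
    qed
    moreover have "T \<subseteq> ?L" using S reach_L by (auto simp: T_def)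
    moreover have "?closed T"
      using S by (auto simp: T_def intro: rtranclp.rtrancl_into_rtrancl)
    ultimately have "T \<in> \<S>" unfolding \<S>_def by blast
    then have "S = T" by (rule max) (auto simp: T_def)
    then show False using yL by (auto simp: T_def)
  qed
  have "satisfies (\<lambda>i. (i, True) \<in> S) C" if C: "C \<in> F" for C
  proof -
    from C F have "C \<in> k_clauses 2 n" by blast
    then obtain l l' where ll: "C = {l, l'}" "fst l \<in> {1..n}" by (rule k_clauses_2E)
    have "implies F (neg l) l'" using C ll(1) by (simp add: implies_def)
    moreover have "l \<in> S \<or> neg l \<in> S" using ll(2) by (intro complete) (simp add: mem_Times_iff)
    ultimately obtain z where z: "z \<in> C" "z \<in> S" using S(2) ll(1) by blast
    then have "((fst z, True) \<in> S) = snd z"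
      using S(3) by (cases z; cases "snd z") (auto simp: neg_def)
    with z(1) show ?thesis by (auto simp: satisfies_def intro!: bexI[of _ z])
  qed
  then show ?thesis by blast
qed

section \<open>Simple paths inside contradictory cycles\<close>

text \<open>Follow the walk from \<open>x\<close>, erasing loops, and stop for good at the first
  edge into the negation of a literal on the current path. Until then no variable repeats.\<close>

lemma simple_path_or_conflict:
  assumes "E\<^sup>*\<^sup>* x y"
  shows "\<exists>ws. ws \<noteq> [] \<and> hd ws = x \<and> successively E ws \<and> distinct (map fst ws) \<and>
           (last ws = y \<or> (\<exists>w\<in>set ws. E (last ws) (neg w)))"
  using assms
proof (induction rule: rtranclp_induct)
  case base
  show ?case by (rule exI[of _ "[x]"]) simp
next
  case (step y z)
  then obtain ws where ws: "ws \<noteq> []" "hd ws = x" "successively E ws" "distinct (map fst ws)"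
      "last ws = y \<or> (\<exists>w\<in>set ws. E (last ws) (neg w))" by blast
  show ?case
  proof (cases "\<exists>w\<in>set ws. E (last ws) (neg w)")
    case True
    with ws show ?thesis by blast
  next
    case False
    then have last: "last ws = y" and nz: "neg z \<notin> set ws"
      using ws(5) step.hyps(2) by (auto intro: bexI[of _ "neg z"])
    show ?thesis
    proof (cases "z \<in> set ws")
      case True
      \<comment> \<open>The walk has returned to \<open>z\<close>: cut the path back to the earlier
        visit.\<close>
      then obtain us vs where ws_eq: "ws = (us @ [z]) @ vs" by (auto dest: split_list)
      have "successively E (us @ [z])" 
        using ws(3) unfolding ws_eq by (subst (asm) successively_append_iff) auto
      then show ?thesis using ws unfolding ws_eq
        by (intro exI[of _ "us @ [z]"]) (auto simp: hd_append)
    next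
      case z: False
      have "fst z \<notin> fst ` set ws" using z nz same_var_cases by (metis imageE neg_simps(1))
      moreover have "successively E (ws @ [z])"
        using ws last step.hyps(2) by (auto simp: successively_append_iff)
      ultimately show ?thesis using ws
        by (intro exI[of _ "ws @ [z]"]) (auto simp: hd_append)
    qed
  qed
qed

text \<open>Trace the walk from \<open>y\<close> to \<open>hd ws\<close> backwards, prepending
  literals until one has a variable already on the path. This one becomes \<open>a\<close>; the
  search ends at \<open>y\<close> at the latest, as its variable is on the path from the
  outset.\<close>

lemma extend_path_backwards:
  assumes "E\<^sup>+\<^sup>+ y (hd ws)" "successively E ws" "distinct (map fst ws)" "ws \<noteq> []"
    "fst y \<in> fst ` set ws"
  shows "\<exists>us a. successively E (us @ ws) \<and> distinct (map fst (us @ ws)) \<and>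
           E a (hd (us @ ws)) \<and> fst a \<in> fst ` set (us @ ws)"
  using assms
proof (induction "hd ws" arbitrary: ws rule: tranclp_induct)
  case base
  then show ?case by (intro exI[of _ "[]"] exI[of _ y]) auto
next
  case (step z)
  show ?case
  proof (cases "fst z \<in> fst ` set ws")
    case True
    with step show ?thesis by (intro exI[of _ "[]"] exI[of _ z]) auto
  next
    case False
    have "\<exists>us a. successively E (us @ z # ws) \<and> distinct (map fst (us @ z # ws)) \<and>
           E a (hd (us @ z # ws)) \<and> fst a \<in> fst ` set (us @ z # ws)"
      by (rule step.hyps(3)) (use False step in \<open>auto simp: successively_Cons\<close>)
    then obtain us a where "successively E (us @ z # ws)" "distinct (map fst (us @ z # ws))"
           "E a (hd (us @ z # ws))" "fst a \<in> fst ` set (us @ z # ws)" by blast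
    then show ?thesis by (intro exI[of _ "us @ [z]"] exI[of _ a]) auto
  qed
qed

section \<open>The clauses along a path\<close>

fun path_clauses :: "literal list \<Rightarrow> clause list" where
  "path_clauses (l # l' # ls) = {neg l, l'} # path_clauses (l' # ls)"
| "path_clauses _ = []"

lemma successively_implies_iff: "successively (implies F) ls \<longleftrightarrow> set (path_clauses ls) \<subseteq> F"
  by (induction ls rule: path_clauses.induct) (auto simp: implies_def)

lemma path_clauses_snoc:
  "ls \<noteq> [] \<Longrightarrow> path_clauses (ls @ [b]) = path_clauses ls @ [{neg (last ls), b}]"
  by (induction ls rule: path_clauses.induct) auto

lemma path_clauses_bicycle:
  "ws \<noteq> [] \<Longrightarrow> path_clauses (a # ws @ [b]) =
     {neg a, hd ws} # path_clauses ws @ [{neg (last ws), b}]"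
  by (cases ws) (use path_clauses_snoc[of ws b] in auto)

text \<open>An edge contributes the negation of its tail and its head. The exact ranges
  \<open>butlast\<close> and \<open>tl\<close> matter: they exclude \<open>neg (last ls)\<close> and
  \<open>hd ls\<close> when the variables on the path are distinct.\<close>

lemma path_clauses_literals:
  "C \<in> set (path_clauses ls) \<Longrightarrow> l \<in> C \<Longrightarrow> neg l \<in> set (butlast ls) \<or> l \<in> set (tl ls)"
  by (induction ls rule: path_clauses.induct) (auto split: if_splits dest: list.set_sel(2))

text \<open>The first clause contains \<open>neg l\<close>, and the variable of \<open>l\<close>
  does not occur further along the path.\<close>

lemma distinct_path_clauses: "distinct (map fst ls) \<Longrightarrow> distinct (path_clauses ls)"
proof (induction ls rule: path_clauses.induct)
  case (1 l l' ls)
  have "{neg l, l'} \<notin> set (path_clauses (l' # ls))"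
  proof
    assume "{neg l, l'} \<in> set (path_clauses (l' # ls))"
    from path_clauses_literals[OF this, of "neg l"]
    have "l \<in> set (l' # ls) \<or> neg l \<in> set (l' # ls)"
      by (metis in_set_butlastD insertI1 list.sel(3) list.set_intros(2) neg_simps(1))
    then have "fst l \<in> fst ` set (l' # ls)"
      by (metis imageI neg_simps(2))
    then show False using 1(2) by simp
  qed
  with 1 show ?case by simp
qed auto

text \<open>
  The bicycles of Chvatal and Reed, with a closing literal \<open>b\<close> that contradicts the path; this
  makes the two end clauses different.
\<close>

lemma distinct_bicycle:
  assumes "distinct (map fst ws)" "ws \<noteq> []" "w \<in> set ws" "b = neg w"
  shows "distinct (path_clauses (a # ws @ [b]))"
proof -
  have var: "l = l'" if "l \<in> set ws" "l' \<in> set ws" "fst l = fst l'" for l l'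
    using assms(1) that by (auto simp: distinct_map inj_on_def)
  have no_neg: "neg l \<notin> set ws" if "l \<in> set ws" for l
    using var[of l "neg l"] that by auto
  have hd: "hd ws \<in> set ws" "hd ws \<notin> set (tl ws)" and last: "last ws \<in> set ws" "last ws \<notin> set (butlast ws)"
  proof -
    show "hd ws \<in> set ws" "last ws \<in> set ws" using assms by auto
    have "distinct ws" using assms(1) by (simp add: distinct_map)
    then show "hd ws \<notin> set (tl ws)" "last ws \<notin> set (butlast ws)"
      using assms(2) by (metis distinct.simps(2) list.collapse, 
        metis append_butlast_last_id distinct_butlast not_distinct_conv_prefix)
  qed
  \<comment> \<open>One end clause contains \<open>hd ws\<close>, the other
    \<open>neg (last ws)\<close>; no inner clause contains either literal.\<close>
  have "hd ws \<notin> C" if "C \<in> set (path_clauses ws)" for C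
    using path_clauses_literals[OF that, of "hd ws"] hd no_neg in_set_butlastD by metis
  moreover have "neg (last ws) \<notin> C" if "C \<in> set (path_clauses ws)" for C
    using path_clauses_literals[OF that, of "neg (last ws)"] last no_neg assms(2)
    by (metis list.set_sel(2) neg_simps(1))
  moreover have "hd ws \<noteq> neg (last ws)" "hd ws \<noteq> b"
    using hd(1) last(1) no_neg assms(3,4) by metis+
  ultimately show ?thesis
    using distinct_path_clauses[OF assms(1)] unfolding path_clauses_bicycle[OF assms(2)] by auto
qed

text \<open>Half of a contradictory cycle, from \<open>x\<close> towards \<open>neg x\<close>, gives
  a simple path that must end in a conflict, which supplies \<open>b\<close>. The other half leads
  from \<open>neg x\<close> back to \<open>x\<close> and so extends the path backwards until it
  yields \<open>a\<close>.\<close>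

lemma unsatisfiable_bicycle:
  assumes F: "set \<Phi> \<subseteq> k_clauses 2 n" and "\<not> satisfiable \<Phi>"
  obtains ws a b where "ws \<noteq> []" "length ws \<le> n" "set ws \<subseteq> {1..n} \<times> UNIV"
    "a \<in> fst ` set ws \<times> UNIV" "b \<in> fst ` set ws \<times> UNIV"
    "distinct (path_clauses (a # ws @ [b]))" "set (path_clauses (a # ws @ [b])) \<subseteq> set \<Phi>"
proof -
  let ?E = "implies (set \<Phi>)"
  obtain x where x: "?E\<^sup>*\<^sup>* x (neg x)" "?E\<^sup>*\<^sup>* (neg x) x"
    using satisfiable_if_no_contradictory_cycle[OF F] assms(2) unfolding satisfiable_def by blast
  obtain vs where vs: "vs \<noteq> []" "hd vs = x" "successively ?E vs" "distinct (map fst vs)"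
     "last vs = neg x \<or> (\<exists>w\<in>set vs. ?E (last vs) (neg w))"
    using simple_path_or_conflict[OF x(1)] by blast
  have "last vs \<noteq> neg x"
  proof
    assume last: "last vs = neg x"
    have "inj_on fst (set vs)" using vs(4) by (simp add: distinct_map)
    moreover have "x \<in> set vs" "neg x \<in> set vs"
      using vs(1,2) last hd_in_set[of vs] last_in_set[of vs] by auto
    ultimately show False by (auto dest: inj_onD[of _ _ x "neg x"])
  qed
  then obtain w where w: "w \<in> set vs" "?E (last vs) (neg w)" using vs(5) by blast
  have cycle: "?E\<^sup>+\<^sup>+ (neg x) (hd vs)" using rtranclpD[OF x(2)] vs(2) by simp
  have x_var: "fst (neg x) \<in> fst ` set vs" using vs(1,2) hd_in_set[of vs] by auto
  from extend_path_backwards[OF cycle vs(3,4,1) x_var]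
  obtain us a where ua: "successively ?E (us @ vs)" "distinct (map fst (us @ vs))"
      "?E a (hd (us @ vs))" "fst a \<in> fst ` set (us @ vs)"
    by (elim exE conjE)
  define ws where "ws = us @ vs"
  note ua = ua[folded ws_def]
  have ws: "ws \<noteq> []" "w \<in> set ws" "last ws = last vs" using vs(1) w by (simp_all add: ws_def)
  have succ: "successively ?E (a # ws @ [neg w])"
    using ua(1,3) w(2) ws by (simp add: successively_append_iff successively_Cons)
  \<comment> \<open>Every literal on the path has an outgoing edge, the last one into
    \<open>neg w\<close>, so its variable is in range.\<close>
  have sub: "set ws \<subseteq> {1..n} \<times> UNIV"
  proof
    fix l assume "l \<in> set ws"
    then obtain us' vs' where "ws = us' @ l # vs'" by (auto dest: split_list)
    with succ have "?E l (hd (vs' @ [neg w]))"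
      by (cases vs') (simp_all add: successively_append_iff successively_Cons)
    then show "l \<in> {1..n} \<times> UNIV" using implies_var[OF F] by (auto simp: mem_Times_iff)
  qed
  have "length ws = card (fst ` set ws)"
    using ua(2) by (metis distinct_card length_map set_map)
  also have "\<dots> \<le> card {1..n}" using sub by (intro card_mono) auto
  finally have len: "length ws \<le> n" by simp
  show thesis
  proof (rule that[of ws a "neg w"])
    show "a \<in> fst ` set ws \<times> UNIV" "neg w \<in> fst ` set ws \<times> UNIV"
      using ua(4) ws(2) by (simp_all add: mem_Times_iff)
    show "distinct (path_clauses (a # ws @ [neg w]))"
      using ua(2) ws by (intro distinct_bicycle) auto
    show "set (path_clauses (a # ws @ [neg w])) \<subseteq> set \<Phi>"
      using succ by (simp only: successively_implies_iff)
  qed (use ws sub len in auto)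
qed

subsection \<open>The chosen clauses\<close>

definition all_negative :: "clause \<Rightarrow> bool" where
  "all_negative C \<longleftrightarrow> (\<forall>l\<in>C. \<not> snd l)"

definition avoid_negative_rule :: rule where
  "avoid_negative_rule H cs = return_pmf (if all_negative (cs ! 0) then cs ! 1 else cs ! 0)"

lemma achlioptas_avoid_negative_rule: "achlioptas_rule 2 k n avoid_negative_rule"
  by (auto simp: achlioptas_rule_def avoid_negative_rule_def)

text \<open>The second clause is drawn only if it is needed; this has the law of the choice between
  two independent clauses.\<close>

definition chosen_clause :: "nat \<Rightarrow> clause pmf" where
  "chosen_clause n = bind_pmf (pmf_of_set (k_clauses 2 n))
     (\<lambda>C. if all_negative C then pmf_of_set (k_clauses 2 n) else return_pmf C)"

abbreviation avoid_negative_formula :: "nat \<Rightarrow> nat \<Rightarrow> formula pmf" where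
  "avoid_negative_formula n \<equiv> achlioptas_formula 2 2 n avoid_negative_rule"

lemma avoid_negative_formula_0: "avoid_negative_formula n 0 = return_pmf []"
  by (simp add: achlioptas_formula_def)

text \<open>The rule ignores the history, so the new clause is independent of the formula so
  far.\<close>

lemma avoid_negative_formula_Suc:
  "avoid_negative_formula n (Suc m) =
     map_pmf (\<lambda>(\<Phi>, C). \<Phi> @ [C]) (pair_pmf (avoid_negative_formula n m) (chosen_clause n))"
proof -
  let ?U = "pmf_of_set (k_clauses 2 n)"
  have "bind_pmf (presented 2 2 n) (avoid_negative_rule H) = chosen_clause n" for H
  proof -
    have "bind_pmf (presented 2 2 n) (avoid_negative_rule H) =
        bind_pmf ?U (\<lambda>x. bind_pmf ?U (\<lambda>y. return_pmf (if all_negative x then y else x)))"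
      by (simp add: presented_def numeral_2_eq_2 bind_assoc_pmf bind_return_pmf avoid_negative_rule_def
          cong: if_cong)
    also have "\<dots> = chosen_clause n"
      unfolding chosen_clause_def
      by (intro bind_pmf_cong refl) (auto simp: bind_return_pmf')
    finally show ?thesis .
  qed
  then have *: "bind_pmf (presented 2 2 n) (\<lambda>cs. bind_pmf (avoid_negative_rule H cs) f) =
      bind_pmf (chosen_clause n) f" for H and f :: "clause \<Rightarrow> formula pmf"
    by (simp flip: bind_assoc_pmf)
  show ?thesis
    by (simp add: achlioptas_formula_def map_bind_pmf * pair_pmf_def bind_map_pmf map_pmf_def
        bind_assoc_pmf bind_return_pmf)
qed

lemma set_pmf_chosen_clause: "2 \<le> n \<Longrightarrow> set_pmf (chosen_clause n) \<subseteq> k_clauses 2 n"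
  by (auto simp: chosen_clause_def k_clauses_nonempty finite_k_clauses split: if_splits)

lemma set_pmf_avoid_negative_formula:
  "2 \<le> n \<Longrightarrow> \<Phi> \<in> set_pmf (avoid_negative_formula n m) \<Longrightarrow> set \<Phi> \<subseteq> k_clauses 2 n"
proof (induction m arbitrary: \<Phi>)
  case (Suc m)
  then show ?case
    using set_pmf_chosen_clause[of n] by (fastforce simp: avoid_negative_formula_Suc)
qed (simp add: avoid_negative_formula_0)

lemma card_all_negative: "card {C \<in> k_clauses k n. all_negative C} = n choose k"
proof -
  have "bij_betw (\<lambda>S. S \<times> {False}) {S. S \<subseteq> {1..n} \<and> card S = k} {C \<in> k_clauses k n. all_negative C}"
  proof (rule bij_betw_byWitness[where f' = "\<lambda>C. fst ` C"])
    show "\<forall>C\<in>{C \<in> k_clauses k n. all_negative C}. fst ` C \<times> {False} = C"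
      by (force simp: all_negative_def)
    show "(\<lambda>S. S \<times> {False}) ` {S. S \<subseteq> {1..n} \<and> card S = k} \<subseteq> {C \<in> k_clauses k n. all_negative C}"
      by (auto simp: k_clauses_def all_negative_def inj_on_def card_cartesian_product)
    show "(`) fst ` {C \<in> k_clauses k n. all_negative C} \<subseteq> {S. S \<subseteq> {1..n} \<and> card S = k}"
      by (auto simp: k_clauses_def card_image)
  qed auto
  then show ?thesis
    using n_subsets[of "{1..n}" k] by (simp add: bij_betw_same_card flip: bij_betw_same_card)
qed

text \<open>With \<open>N = n (n - 1)\<close> there are \<open>2 N\<close> clauses, a quarter of
  them all negative. Being drawn second contributes at most \<open>1/4 * 1/(2 N) = 1/(8 N)\<close>;
  being accepted first adds \<open>1/(2 N)\<close>, but only if \<open>D\<close> is not all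
  negative.\<close>

lemma pmf_chosen_clause_le:
  assumes "2 \<le> n"
  shows "pmf (chosen_clause n) D \<le> (if all_negative D then 1/8 else 5/8) / (real n * (real n - 1))"
proof -
  let ?K = "k_clauses 2 n" and ?U = "pmf_of_set (k_clauses 2 n)"
  define N where "N = real n * (real n - 1)"
  have ch: "real (n choose 2) = N / 2"
    using assms by (simp add: N_def choose_two real_of_nat_div of_nat_diff)
  have K: "real (card ?K) = 2 * N"
    using ch by (simp add: card_k_clauses)
  have N: "N > 0" using assms by (simp add: N_def)
  have KI: "finite ?K" "?K \<noteq> {}" using assms by (simp_all add: finite_k_clauses k_clauses_nonempty)
  have U: "pmf ?U D \<le> 1 / (2 * N)"
    using N K KI by (auto simp: indicator_def)
  have "pmf (chosen_clause n) D = (\<Sum>C\<in>?K. pmf (if all_negative C then ?U else return_pmf C) D) / (2 * N)"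
    unfolding chosen_clause_def by (subst pmf_bind_pmf_of_set[OF KI(2,1)]) (simp only: K)
  also have "\<dots> \<le> (\<Sum>C\<in>?K. (if all_negative C then 1 / (2 * N) else 0) +
                    (if C = D then if all_negative D then 0 else 1 else 0)) / (2 * N)"
    using N U by (intro divide_right_mono sum_mono) (auto simp: indicator_def)
  also have "(\<Sum>C\<in>?K. (if all_negative C then 1 / (2 * N) else 0) +
                    (if C = D then if all_negative D then 0 else 1 else 0)) =
      real (card {C \<in> ?K. all_negative C}) / (2 * N) +
        (if D \<in> ?K then if all_negative D then 0 else 1 else 0)"
    using KI by (simp add: sum.distrib sum.If_cases Int_def)
  also have "\<dots> \<le> 1 / 4 + (if all_negative D then 0 else 1)"
    using N by (simp add: card_all_negative ch)
  finally show ?thesis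
    using N by (fold N_def) (auto simp: field_simps split: if_splits)
qed

section \<open>The probability that given clauses all occur\<close>

text \<open>These are the terms of degree at most one in \<open>y\<close> when the product is
  expanded; the others are nonnegative.\<close>

lemma prod_plus_sum_le_prod_add:
  fixes x y :: "'a \<Rightarrow> real"
  assumes "finite S" "\<And>i. i \<in> S \<Longrightarrow> 0 \<le> x i" "\<And>i. i \<in> S \<Longrightarrow> 0 \<le> y i"
  shows "prod x S + (\<Sum>i\<in>S. y i * prod x (S - {i})) \<le> (\<Prod>i\<in>S. x i + y i)"
  using assms
proof (induction S rule: finite_induct)
  case (insert j S)
  have "(\<Sum>i\<in>S. y i * prod x (insert j S - {i})) = x j * (\<Sum>i\<in>S. y i * prod x (S - {i}))"
    unfolding sum_distrib_left
  proof (rule sum.cong)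
    fix i assume "i \<in> S"
    then have "insert j S - {i} = insert j (S - {i})" using insert.hyps by auto
    then show "y i * prod x (insert j S - {i}) = x j * (y i * prod x (S - {i}))"
      using insert.hyps by simp
  qed simp
  moreover have "insert j S - {j} = S" using insert.hyps by simp
  ultimately have "prod x (insert j S) + (\<Sum>i\<in>insert j S. y i * prod x (insert j S - {i})) =
      x j * (prod x S + (\<Sum>i\<in>S. y i * prod x (S - {i}))) + y j * prod x S"
    using insert.hyps by (simp add: algebra_simps)
  also have "\<dots> \<le> x j * (\<Prod>i\<in>S. x i + y i) + y j * (\<Prod>i\<in>S. x i + y i)"
    using insert by (intro add_mono mult_left_mono prod_mono) auto
  also have "\<dots> = (\<Prod>i\<in>insert j S. x i + y i)"
    using insert.hyps by (simp add: algebra_simps)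
  finally show ?case .
qed simp

lemma prob_pair_pmf_Times:
  "measure_pmf.prob (pair_pmf p q) (A \<times> B) = measure_pmf.prob p A * measure_pmf.prob q B"
proof -
  \<comment> \<open>Intersecting with the supports makes both sets countable.\<close>
  have "measure_pmf.prob (pair_pmf p q) (A \<times> B) =
      measure_pmf.prob (pair_pmf p q) ((A \<inter> set_pmf p) \<times> (B \<inter> set_pmf q))"
    by (subst measure_Int_set_pmf[symmetric]) (simp add: Times_Int_Times)
  also have "\<dots> = measure_pmf.prob p A * measure_pmf.prob q B"
    by (subst measure_pmf_prob_product) (auto simp: measure_Int_set_pmf)
  finally show ?thesis .
qed

text \<open>Induction on the number of steps: either \<open>S\<close> has occurred before the last
  step, or the last clause is some \<open>D\<close> in \<open>S\<close> and \<open>S - {D}\<close>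
  has occurred before. A union bound and the product inequality turn the factors \<open>m p\<close>
  into \<open>m p + p\<close>.\<close>

lemma prob_clauses_subset_le:
  assumes "finite S"
  shows "measure_pmf.prob (avoid_negative_formula n m) {\<Phi>. S \<subseteq> set \<Phi>}
           \<le> (\<Prod>D\<in>S. real m * pmf (chosen_clause n) D)"
  using assms
proof (induction m arbitrary: S)
  case 0
  then show ?case
    by (cases "S = {}") (auto simp: avoid_negative_formula_0 indicator_def)
next
  case (Suc m)
  let ?F = "avoid_negative_formula n m" and ?c = "chosen_clause n"
  let ?A = "\<lambda>S. {\<Phi>. S \<subseteq> set \<Phi>}"
  have "measure_pmf.prob (avoid_negative_formula n (Suc m)) (?A S) =
      measure_pmf.prob (pair_pmf ?F ?c) {(\<Phi>, C). S \<subseteq> insert C (set \<Phi>)}"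
    by (simp add: avoid_negative_formula_Suc vimage_def case_prod_unfold)
  also have "\<dots> \<le> measure_pmf.prob (pair_pmf ?F ?c) (?A S \<times> UNIV \<union> (\<Union>D\<in>S. ?A (S - {D}) \<times> {D}))"
    by (intro measure_pmf.finite_measure_mono) auto
  also have "\<dots> \<le> measure_pmf.prob (pair_pmf ?F ?c) (?A S \<times> UNIV) +
      measure_pmf.prob (pair_pmf ?F ?c) (\<Union>D\<in>S. ?A (S - {D}) \<times> {D})"
    by (intro measure_Un_le) auto
  also have "\<dots> \<le> measure_pmf.prob (pair_pmf ?F ?c) (?A S \<times> UNIV) +
      (\<Sum>D\<in>S. measure_pmf.prob (pair_pmf ?F ?c) (?A (S - {D}) \<times> {D}))"
    using Suc.prems by (intro add_left_mono measure_pmf.finite_measure_subadditive_finite) auto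
  also have "\<dots> = measure_pmf.prob ?F (?A S) + (\<Sum>D\<in>S. pmf ?c D * measure_pmf.prob ?F (?A (S - {D})))"
    by (simp add: prob_pair_pmf_Times measure_pmf_single mult.commute)
  also have "\<dots> \<le> (\<Prod>D\<in>S. real m * pmf ?c D) +
      (\<Sum>D\<in>S. pmf ?c D * (\<Prod>D\<in>S - {D}. real m * pmf ?c D))"
    using Suc.prems by (intro add_mono sum_mono mult_left_mono Suc.IH) auto
  also have "\<dots> \<le> (\<Prod>D\<in>S. real m * pmf ?c D + pmf ?c D)"
    using Suc.prems by (intro prod_plus_sum_le_prod_add) auto
  also have "\<dots> = (\<Prod>D\<in>S. real (Suc m) * pmf ?c D)"
    by (simp add: algebra_simps)
  finally show ?case .
qed

section \<open>Weighted sums over paths\<close>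

text \<open>The transfer matrix with entries \<open>g {neg l, l'}\<close> maps \<open>v\<close> to
  at most \<open>\<kappa> v\<close> entrywise. Splitting off the first edge iterates this
  \<open>s\<close> times.\<close>

lemma sum_path_weights_le:
  fixes g :: "clause \<Rightarrow> real" and v :: "literal \<Rightarrow> real"
  assumes "finite L" "\<And>C. 0 \<le> g C" "0 \<le> \<kappa>"
    and step: "\<And>l. l \<in> L \<Longrightarrow> (\<Sum>l'\<in>L. g {neg l, l'} * v l') \<le> \<kappa> * v l"
    and "l \<in> L"
  shows "(\<Sum>ws | set ws \<subseteq> L \<and> length ws = s. prod_list (map g (path_clauses (l # ws))) * v (last (l # ws)))
           \<le> \<kappa> ^ s * v l"
  using \<open>l \<in> L\<close>
proof (induction s arbitrary: l)
  case 0
  have "{ws. set ws \<subseteq> L \<and> length ws = 0} = {[]}" by auto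
  then show ?case by simp
next
  case (Suc s)
  let ?W = "\<lambda>s. {ws. set ws \<subseteq> L \<and> length ws = s}"
  let ?p = "\<lambda>l ws. prod_list (map g (path_clauses (l # ws))) * v (last (l # ws))"
  have "(\<Sum>ws\<in>?W (Suc s). ?p l ws) = (\<Sum>(ws, l')\<in>?W s \<times> L. ?p l (l' # ws))"
    unfolding lists_length_Suc_eq by (subst sum.reindex) (auto simp: inj_on_def case_prod_unfold)
  also have "\<dots> = (\<Sum>ws\<in>?W s. \<Sum>l'\<in>L. ?p l (l' # ws))"
    by (rule sum.cartesian_product[symmetric])
  also have "\<dots> = (\<Sum>l'\<in>L. \<Sum>ws\<in>?W s. ?p l (l' # ws))"
    by (rule sum.swap)
  also have "\<dots> = (\<Sum>l'\<in>L. g {neg l, l'} * (\<Sum>ws\<in>?W s. ?p l' ws))"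
    by (simp add: sum_distrib_left mult.assoc)
  also have "\<dots> \<le> (\<Sum>l'\<in>L. g {neg l, l'} * (\<kappa> ^ s * v l'))"
    using assms(2) Suc.IH by (intro sum_mono mult_left_mono) auto
  also have "\<dots> = \<kappa> ^ s * (\<Sum>l'\<in>L. g {neg l, l'} * v l')"
    by (simp add: sum_distrib_left mult_ac)
  also have "\<dots> \<le> \<kappa> ^ s * (\<kappa> * v l)"
    using assms(3) step[OF Suc.prems] by (intro mult_left_mono) auto
  finally show ?case by (simp add: mult_ac)
qed

subsection \<open>First moment of bicycles\<close>

text \<open>The two end clauses are bounded uniformly by \<open>\<beta>\<close>, while the inner
  path keeps its exact weights for later summation. Distinctness makes the product over the set of
  clauses a product over the list; as part of the event, it leaves nothing to prove when it
  fails.\<close>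

lemma prob_bicycle_le:
  fixes m n :: nat and g :: "clause \<Rightarrow> real"
  defines "g \<equiv> \<lambda>D. real m * pmf (chosen_clause n) D"
  assumes "ws \<noteq> []" and \<beta>: "\<And>D. g D \<le> \<beta>"
  shows "measure_pmf.prob (avoid_negative_formula n m)
           {\<Phi>. distinct (path_clauses (a # ws @ [b])) \<and> set (path_clauses (a # ws @ [b])) \<subseteq> set \<Phi>}
         \<le> \<beta>\<^sup>2 * prod_list (map g (path_clauses ws))"
proof (cases "distinct (path_clauses (a # ws @ [b]))")
  case True
  have g: "0 \<le> g D" for D by (simp add: g_def)
  have P: "0 \<le> prod_list (map g (path_clauses ws))"
    by (rule prod_list_nonneg) (use g in auto)
  have "measure_pmf.prob (avoid_negative_formula n m)
           {\<Phi>. distinct (path_clauses (a # ws @ [b])) \<and> set (path_clauses (a # ws @ [b])) \<subseteq> set \<Phi>}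
        \<le> prod g (set (path_clauses (a # ws @ [b])))"
    using prob_clauses_subset_le[of "set (path_clauses (a # ws @ [b]))"] True by (simp add: g_def)
  also have "\<dots> = prod_list (map g (path_clauses (a # ws @ [b])))"
    using True by (rule prod.distinct_set_conv_list)
  also have "\<dots> = g {neg a, hd ws} * g {neg (last ws), b} * prod_list (map g (path_clauses ws))"
    by (simp add: path_clauses_bicycle[OF assms(2)])
  also have "\<dots> \<le> \<beta>\<^sup>2 * prod_list (map g (path_clauses ws))"
    unfolding power2_eq_square using g P \<beta>
    by (intro mult_right_mono mult_mono) (auto intro: order_trans)
  finally show ?thesis .
next
  case False
  have "0 \<le> prod_list (map g (path_clauses ws))"
    by (rule prod_list_nonneg) (auto simp: g_def)
  with False show ?thesis by simp
qed

text \<open>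
  The weights \<open>4\<close> and \<open>9\<close> approximate the Perron eigenvector \<open>(1, sqrt 5)\<close> of the
  \<open>2 \<times> 2\<close> matrix that counts the implications of a positive and of a negative literal
  by the sign of the implied literal.
\<close>

definition sign_weight :: "literal \<Rightarrow> real" where
  "sign_weight l = (if snd l then 4 else 9)"

lemma sum_implied_sign_weight_le:
  assumes "2 \<le> n"
  shows "(\<Sum>l'\<in>{1..n} \<times> UNIV. (real m * pmf (chosen_clause n) {neg l, l'}) * sign_weight l')
           \<le> 29/32 * real m / (real n - 1) * sign_weight l"
proof -
  define r where "r = real m / (real n * (real n - 1))"
  have r: "0 \<le> r" using assms by (simp add: r_def)
  have "(\<Sum>l'\<in>{1..n} \<times> UNIV. (real m * pmf (chosen_clause n) {neg l, l'}) * sign_weight l')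
      \<le> (\<Sum>l'\<in>{1..n} \<times> UNIV. r * (if snd l \<and> \<not> snd l' then 1/8 else 5/8) * sign_weight l')"
  proof (intro sum_mono mult_right_mono)
    fix l'
    show "real m * pmf (chosen_clause n) {neg l, l'} \<le> r * (if snd l \<and> \<not> snd l' then 1/8 else 5/8)"
      using mult_left_mono[OF pmf_chosen_clause_le[OF assms, of "{neg l, l'}"], of "real m"]
      by (auto simp: all_negative_def r_def)
  qed (simp add: sign_weight_def)
  \<comment> \<open>From a positive literal: \<open>5/8 * 4 + 1/8 * 9 = 29/8\<close>, exactly
    \<open>29/32 * 4\<close>. From a negative one: \<open>5/8 * (4 + 9) = 65/8\<close>, slightly
    below \<open>29/32 * 9\<close>.\<close>
  also have "\<dots> = real n * r * (if snd l then 29/8 else 65/8)"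
    unfolding sum.cartesian_product' by (simp add: sign_weight_def UNIV_bool)
  also have "\<dots> \<le> real n * r * (29/32 * sign_weight l)"
    using r by (intro mult_left_mono) (auto simp: sign_weight_def)
  also have "\<dots> = 29/32 * real m / (real n - 1) * sign_weight l"
    using assms by (simp add: r_def mult_ac)
  finally show ?thesis .
qed

text \<open>Union bound over bicycles whose path has \<open>s\<close> edges and \<open>s + 1\<close>
  literals: at most \<open>4 (s + 1)^2\<close> pairs of closing literals, times total path weight at
  most \<open>9/2 n \<kappa>^s\<close>, which gives the factor 18.\<close>

lemma prob_unsatisfiable_le:
  fixes n m :: nat
  defines "\<beta> \<equiv> real m * (5/8) / (real n * (real n - 1))" and "\<kappa> \<equiv> 29/32 * real m / (real n - 1)"
  assumes n: "2 \<le> n"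
  shows "measure_pmf.prob (avoid_negative_formula n m) {\<Phi>. \<not> satisfiable \<Phi>}
           \<le> 18 * real n * \<beta>\<^sup>2 * (\<Sum>s<n. real (Suc s)^2 * \<kappa> ^ s)"
proof -
  let ?F = "avoid_negative_formula n m"
  let ?L = "{1..n} \<times> (UNIV :: bool set)"
  let ?W = "\<lambda>s. {ws. set ws \<subseteq> ?L \<and> length ws = s}"
  let ?V = "\<lambda>ws :: literal list. fst ` set ws \<times> (UNIV :: bool set)"
  let ?A = "\<lambda>ws (a, b). {\<Phi>. distinct (path_clauses (a # ws @ [b])) \<and>
                  set (path_clauses (a # ws @ [b])) \<subseteq> set \<Phi>}"
  define g where "g = (\<lambda>D. real m * pmf (chosen_clause n) D)"
  let ?P = "\<lambda>ws. prod_list (map g (path_clauses ws))"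
  have finW: "finite (?W s)" for s by (rule finite_lists_length_eq) simp
  have g0: "0 \<le> g D" for D by (simp add: g_def)
  have P0: "0 \<le> ?P ws" for ws by (rule prod_list_nonneg) (use g0 in auto)
  have \<kappa>: "0 \<le> \<kappa>" using n by (simp add: \<kappa>_def)
  have \<beta>: "g D \<le> \<beta>" for D
  proof -
    have "g D \<le> real m * ((if all_negative D then 1/8 else 5/8) / (real n * (real n - 1)))"
      unfolding g_def by (intro mult_left_mono pmf_chosen_clause_le n) simp
    also have "\<dots> \<le> real m * ((5/8) / (real n * (real n - 1)))"
      using n by (intro mult_left_mono divide_right_mono) auto
    finally show ?thesis by (simp add: \<beta>_def)
  qed
  have path_sum: "(\<Sum>ws\<in>?W (Suc s). ?P ws) \<le> 9/2 * real n * \<kappa> ^ s" for s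
  proof -
    let ?w = "\<lambda>ws. ?P ws * sign_weight (last ws)"
    \<comment> \<open>Weights are at least 4 at the last literal and at most 9 at each of the
      \<open>2 n\<close> first ones, hence \<open>2 n * 9 / 4 = 9/2 n\<close>.\<close>
    have "4 * (\<Sum>ws\<in>?W (Suc s). ?P ws) \<le> (\<Sum>ws\<in>?W (Suc s). ?w ws)"
      unfolding sum_distrib_left
      by (intro sum_mono) (use P0 in \<open>auto simp: sign_weight_def intro: mult_left_mono\<close>)
    also have "\<dots> = (\<Sum>(ws, l)\<in>?W s \<times> ?L. ?w (l # ws))"
      unfolding lists_length_Suc_eq by (subst sum.reindex) (auto simp: inj_on_def case_prod_unfold)
    also have "\<dots> = (\<Sum>ws\<in>?W s. \<Sum>l\<in>?L. ?w (l # ws))"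
      by (rule sum.cartesian_product[symmetric])
    also have "\<dots> = (\<Sum>l\<in>?L. \<Sum>ws\<in>?W s. ?w (l # ws))"
      by (rule sum.swap)
    also have "\<dots> \<le> (\<Sum>l\<in>?L. \<kappa> ^ s * sign_weight l)"
      using sum_implied_sign_weight_le[OF n, of m] g0 \<kappa>
      by (intro sum_mono sum_path_weights_le) (auto simp: g_def \<kappa>_def)
    also have "\<dots> \<le> (\<Sum>l\<in>?L. \<kappa> ^ s * 9)"
      using \<kappa> by (intro sum_mono mult_left_mono) (auto simp: sign_weight_def)
    finally show ?thesis by (simp add: card_cartesian_product mult_ac)
  qed
  have cardV: "real (card (?V ws \<times> ?V ws)) \<le> 4 * real (length ws)^2" for ws
  proof -
    have "card (?V ws) \<le> length ws * 2"
      using card_image_le[of "set ws" fst] card_length[of ws] by (simp add: card_cartesian_product)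
    then have "card (?V ws \<times> ?V ws) \<le> (length ws * 2) * (length ws * 2)"
      unfolding card_cartesian_product[of "?V ws" "?V ws"] by (intro mult_le_mono)
    then have "real (card (?V ws \<times> ?V ws)) \<le> real ((length ws * 2) * (length ws * 2))"
      by (rule of_nat_mono)
    then show ?thesis by (simp add: power2_eq_square)
  qed
  \<comment> \<open>Restricting to the support guarantees that all clauses are 2-clauses, as the
    bicycle argument requires.\<close>
  have "measure_pmf.prob ?F {\<Phi>. \<not> satisfiable \<Phi>} =
      measure_pmf.prob ?F ({\<Phi>. \<not> satisfiable \<Phi>} \<inter> set_pmf ?F)"
    by (simp add: measure_Int_set_pmf)
  also have "\<dots> \<le> measure_pmf.prob ?F (\<Union>s<n. \<Union>ws\<in>?W (Suc s). \<Union>p\<in>?V ws \<times> ?V ws. ?A ws p)"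
  proof (intro measure_pmf.finite_measure_mono subsetI)
    fix \<Phi> assume "\<Phi> \<in> {\<Phi>. \<not> satisfiable \<Phi>} \<inter> set_pmf ?F"
    then have "set \<Phi> \<subseteq> k_clauses 2 n" "\<not> satisfiable \<Phi>"
      using set_pmf_avoid_negative_formula[OF n] by auto
    then obtain ws a b where *: "ws \<noteq> []" "length ws \<le> n" "set ws \<subseteq> ?L" "a \<in> ?V ws" "b \<in> ?V ws"
      "distinct (path_clauses (a # ws @ [b]))" "set (path_clauses (a # ws @ [b])) \<subseteq> set \<Phi>"
      by (rule unsatisfiable_bicycle)
    have "length ws - 1 < n" using *(1,2) by (cases ws) auto
    moreover have "ws \<in> ?W (Suc (length ws - 1))" "(a, b) \<in> ?V ws \<times> ?V ws" "\<Phi> \<in> ?A ws (a, b)"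
      using * by (simp_all del: path_clauses.simps)
    ultimately show "\<Phi> \<in> (\<Union>s<n. \<Union>ws\<in>?W (Suc s). \<Union>p\<in>?V ws \<times> ?V ws. ?A ws p)"
      by blast
  qed simp
  also have "\<dots> \<le> (\<Sum>s<n. measure_pmf.prob ?F (\<Union>ws\<in>?W (Suc s). \<Union>p\<in>?V ws \<times> ?V ws. ?A ws p))"
    by (rule measure_UNION_le) auto
  also have "\<dots> \<le> (\<Sum>s<n. \<Sum>ws\<in>?W (Suc s). measure_pmf.prob ?F (\<Union>p\<in>?V ws \<times> ?V ws. ?A ws p))"
    by (intro sum_mono measure_UNION_le finW) simp
  also have "\<dots> \<le> (\<Sum>s<n. \<Sum>ws\<in>?W (Suc s). 4 * real (Suc s)^2 * (\<beta>\<^sup>2 * ?P ws))"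
  proof (intro sum_mono)
    fix s ws assume ws: "ws \<in> ?W (Suc s)"
    have "measure_pmf.prob ?F (\<Union>p\<in>?V ws \<times> ?V ws. ?A ws p)
        \<le> (\<Sum>p\<in>?V ws \<times> ?V ws. measure_pmf.prob ?F (?A ws p))"
      by (rule measure_UNION_le) auto
    also have "\<dots> \<le> (\<Sum>p\<in>?V ws \<times> ?V ws. \<beta>\<^sup>2 * ?P ws)"
    proof (intro sum_mono)
      fix p
      have "ws \<noteq> []" using ws by auto
      then show "measure_pmf.prob ?F (?A ws p) \<le> \<beta>\<^sup>2 * ?P ws"
        using prob_bicycle_le[of ws m n \<beta> "fst p" "snd p"] \<beta> unfolding g_def
        by (simp add: case_prod_unfold del: path_clauses.simps)
    qed
    also have "\<dots> = real (card (?V ws \<times> ?V ws)) * (\<beta>\<^sup>2 * ?P ws)"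
      by simp
    also have "\<dots> \<le> 4 * real (length ws)^2 * (\<beta>\<^sup>2 * ?P ws)"
      by (intro mult_right_mono cardV mult_nonneg_nonneg P0) simp
    finally show "measure_pmf.prob ?F (\<Union>p\<in>?V ws \<times> ?V ws. ?A ws p) \<le>
        4 * real (Suc s)^2 * (\<beta>\<^sup>2 * ?P ws)"
      using ws by simp
  qed
  also have "\<dots> = (\<Sum>s<n. 4 * real (Suc s)^2 * \<beta>\<^sup>2 * (\<Sum>ws\<in>?W (Suc s). ?P ws))"
    by (simp add: sum_distrib_left mult.assoc)
  also have "\<dots> \<le> (\<Sum>s<n. 4 * real (Suc s)^2 * \<beta>\<^sup>2 * (9/2 * real n * \<kappa> ^ s))"
    by (intro sum_mono mult_left_mono path_sum) simp
  also have "\<dots> = 18 * real n * \<beta>\<^sup>2 * (\<Sum>s<n. real (Suc s)^2 * \<kappa> ^ s)"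
    by (simp add: sum_distrib_left mult_ac)
  finally show ?thesis .
qed

section \<open>Convergence at density 1.055\<close>

theorem theorem2:
  shows "\<exists>R :: nat \<Rightarrow> rule.
           (\<forall>n. achlioptas_rule 2 2 n (R n)) \<and>
           (\<lambda>n. measure_pmf.prob (achlioptas_formula 2 2 n (R n) (nat \<lfloor>1.055 * real n\<rfloor>))
                  {\<Phi>. satisfiable \<Phi>}) \<longlonglongrightarrow> 1"
proof (intro exI conjI allI)
  show "achlioptas_rule 2 2 n avoid_negative_rule" for n
    by (rule achlioptas_avoid_negative_rule)
  define m where "m = (\<lambda>n. nat \<lfloor>1.055 * real n\<rfloor>)"
  let ?F = "\<lambda>n. avoid_negative_formula n (m n)"
  define S where "S = (\<Sum>s. real (Suc s)^2 * (24/25) ^ s)"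
  have sum: "summable (\<lambda>s. real (Suc s)^2 * (24/25 :: real) ^ s)"
  proof (rule summable_comparison_test_bigo)
    \<comment> \<open>Any ratio strictly between \<open>24/25\<close> and 1 absorbs the quadratic
      factor.\<close>
    show "summable (\<lambda>s. norm ((49/50 :: real) ^ s))" by simp
    show "(\<lambda>s. real (Suc s)^2 * (24/25 :: real) ^ s) \<in> O(\<lambda>s. (49/50) ^ s)" by real_asymp
  qed
  \<comment> \<open>\<open>29/32 * 1.055\<close> is about 0.9561, so \<open>24/25\<close> leaves
    room for replacing \<open>n\<close> by \<open>n - 1\<close> once \<open>n\<close> is at least
    246; 250 is a round choice.\<close>
  have bound: "measure_pmf.prob (?F n) {\<Phi>. \<not> satisfiable \<Phi>} \<le> 18 * real n / (real n - 1)\<^sup>2 * S"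
    if n: "250 \<le> n" for n
  proof -
    have m: "real (m n) \<le> 1.055 * real n" unfolding m_def by (rule of_nat_floor) simp
    have \<kappa>: "29/32 * real (m n) / (real n - 1) \<le> 24/25"
      using m n by (simp add: divide_simps)
    have \<beta>: "real (m n) * (5/8) / (real n * (real n - 1)) \<le> 1 / (real n - 1)"
      using m n by (simp add: divide_simps)
    have "(\<Sum>s<n. real (Suc s)^2 * (29/32 * real (m n) / (real n - 1)) ^ s)
        \<le> (\<Sum>s<n. real (Suc s)^2 * (24/25) ^ s)"
      using n \<kappa> by (intro sum_mono mult_left_mono power_mono) auto
    also have "\<dots> \<le> S"
      unfolding S_def by (rule sum_le_suminf[OF sum]) auto
    finally have "(\<Sum>s<n. real (Suc s)^2 * (29/32 * real (m n) / (real n - 1)) ^ s) \<le> S" .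
    moreover have "(real (m n) * (5/8) / (real n * (real n - 1)))\<^sup>2 \<le> (1 / (real n - 1))\<^sup>2"
      using n by (intro power_mono \<beta>) auto
    ultimately have "18 * real n * (real (m n) * (5/8) / (real n * (real n - 1)))\<^sup>2 *
        (\<Sum>s<n. real (Suc s)^2 * (29/32 * real (m n) / (real n - 1)) ^ s)
        \<le> 18 * real n * (1 / (real n - 1))\<^sup>2 * S"
      using n by (intro mult_mono) (auto intro!: sum_nonneg)
    with prob_unsatisfiable_le[of n "m n"] n show ?thesis
      by (simp add: power_divide)
  qed
  \<comment> \<open>As \<open>S\<close> does not depend on \<open>n\<close>, the bound is of order
    \<open>1/n\<close>.\<close>
  have "(\<lambda>n. measure_pmf.prob (?F n) {\<Phi>. \<not> satisfiable \<Phi>}) \<longlonglongrightarrow> 0"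
  proof (rule tendsto_sandwich[OF _ _ tendsto_const])
    show "\<forall>\<^sub>F n in sequentially. measure_pmf.prob (?F n) {\<Phi>. \<not> satisfiable \<Phi>} \<le>
        18 * real n / (real n - 1)\<^sup>2 * S"
      using bound by (rule eventually_sequentiallyI)
    show "(\<lambda>n. 18 * real n / (real n - 1)\<^sup>2 * S) \<longlonglongrightarrow> 0" by real_asymp
  qed auto
  then have "(\<lambda>n. 1 - measure_pmf.prob (?F n) {\<Phi>. \<not> satisfiable \<Phi>}) \<longlonglongrightarrow> 1 - 0"
    by (intro tendsto_intros)
  moreover have "measure_pmf.prob (?F n) {\<Phi>. satisfiable \<Phi>} =
      1 - measure_pmf.prob (?F n) {\<Phi>. \<not> satisfiable \<Phi>}" for n
    using measure_pmf.prob_compl[of "{\<Phi>. \<not> satisfiable \<Phi>}" "?F n"]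
    by (simp add: Collect_neg_eq[symmetric] Compl_eq_Diff_UNIV[symmetric])
  ultimately show "(\<lambda>n. measure_pmf.prob (achlioptas_formula 2 2 n avoid_negative_rule
      (nat \<lfloor>1.055 * real n\<rfloor>)) {\<Phi>. satisfiable \<Phi>}) \<longlonglongrightarrow> 1"
    by (simp add: m_def)
qed

end
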